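(* Let $c$ be a fixed real number. The distribution of the number of fixed points of the permutation in $S_n$ obtained after multiplying $\lfloor n\log n+cn\rfloor$ independent random star transpositions, starting from the identity, converges to the Poisson$(1+e^{-c})$ distribution as $n\to\infty$.
   Context: The star transposition walk on $S_n$ is driven by the probability measure $Q$ on $S_n$ with $Q(\pi)=\frac1{n-1}$ if $\pi$ is one of the transpositions $(1\,i)$, $2\le i\le n$, and $Q(\pi)=0$ otherwise. At each step one moves from $g$ to $hg$ with $h$ sampled independently from $Q$; after $k$ steps started at the identity the law of the permutation is the $k$-fold convolution $Q^{*k}$. Convergence is convergence in distribution. *)

theory Defs
  imports "HOL-Probability.Probability" "HOL-Combinatorics.Permutations"
begin

text \<open>
  The symmetric group on \<open>{1..n}\<close> is represented by the functions \<open>\<pi> :: nat \<Rightarrow> nat\<close> with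
  \<open>\<pi> permutes {1..n}\<close>; such functions are the identity outside \<open>{1..n}\<close>, and the product \<open>h g\<close>
  is the composition \<open>h \<circ> g\<close>.
\<close>

text \<open>Meaningful for \<open>n \<ge> 2\<close> only: otherwise there is no star transposition.\<close>

definition star_transposition_pmf :: "nat \<Rightarrow> (nat \<Rightarrow> nat) pmf" where
  "star_transposition_pmf n = pmf_of_set {Transposition.transpose 1 i | i. i \<in> {2..n}}"

lemma pmf_star_transposition_pmf:
  assumes "n \<ge> 2"
  shows "pmf (star_transposition_pmf n) \<pi> =
    (if \<exists>i\<in>{2..n}. \<pi> = Transposition.transpose 1 i then 1 / (real n - 1) else 0)"
proof -
  have eq: "{Transposition.transpose 1 i | i. i \<in> {2..n}} = (\<lambda>i::nat. Transposition.transpose 1 i) ` {2..n}"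
    by auto
  have "inj_on (\<lambda>i::nat. Transposition.transpose 1 i) {2..n}"
    by (rule inj_onI) (metis transpose_apply_first)
  then have "card ((\<lambda>i::nat. Transposition.transpose 1 i) ` {2..n}) = n - 1"
    by (simp add: card_image)
  then show ?thesis
    using assms unfolding star_transposition_pmf_def eq
    by (subst pmf_of_set) (auto simp: indicator_def of_nat_diff)
qed

text \<open>
  The law of the walk after \<open>k\<close> steps from the identity, each step moving from \<open>g\<close> to \<open>h \<circ> g\<close>
  with an independent \<open>h\<close> drawn from \<open>Q\<close>; this is the \<open>k\<close>-fold convolution power of \<open>Q\<close>.
\<close>

primrec conv_power :: "('a \<Rightarrow> 'a) pmf \<Rightarrow> nat \<Rightarrow> ('a \<Rightarrow> 'a) pmf" where
  "conv_power Q 0 = return_pmf id"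
| "conv_power Q (Suc k) =
     bind_pmf (conv_power Q k) (\<lambda>g. map_pmf (\<lambda>h. h \<circ> g) Q)"

lemma conv_power_star_permutes:
  assumes "n \<ge> 2" "\<pi> \<in> set_pmf (conv_power (star_transposition_pmf n) k)"
  shows "\<pi> permutes {1..n}"
  using assms(2)
proof (induction k arbitrary: \<pi>)
  case 0
  then show ?case by (simp add: permutes_id[unfolded id_def] id_def)
next
  case (Suc k)
  have "{Transposition.transpose 1 i | i. i \<in> {2..n}} = (\<lambda>i::nat. Transposition.transpose 1 i) ` {2..n}"
    by auto
  with assms(1) have set: "set_pmf (star_transposition_pmf n) = (\<lambda>i. Transposition.transpose 1 i) ` {2..n}"
    unfolding star_transposition_pmf_def by (subst set_pmf_of_set) auto
  from Suc.prems obtain g i where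
    g: "g \<in> set_pmf (conv_power (star_transposition_pmf n) k)" and i: "i \<in> {2..n}"
    and \<pi>: "\<pi> = Transposition.transpose 1 i \<circ> g"
    by (auto simp: set)
  have "Transposition.transpose 1 i permutes {1..n}"
    using i by (intro permutes_swap_id) auto
  then show ?case
    unfolding \<pi> using Suc.IH[OF g] by (intro permutes_compose)
qed

definition num_fixed_points :: "nat \<Rightarrow> (nat \<Rightarrow> nat) \<Rightarrow> nat" where
  "num_fixed_points n \<pi> = card {x \<in> {1..n}. \<pi> x = x}"

text \<open>
  The number of steps; \<open>nat\<close> truncates a negative value to \<open>0\<close>, which for fixed \<open>c\<close> affects only
  finitely many \<open>n\<close>.
\<close>

definition walk_steps :: "real \<Rightarrow> nat \<Rightarrow> nat" where
  "walk_steps c n = nat \<lfloor>real n * ln (real n) + c * real n\<rfloor>"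

end

theory Submission
  imports Defs "HOL-Real_Asymp.Real_Asymp"
begin

text \<open>
  Let \<open>N = n - 1\<close> and let \<open>a\<close> be the number of fixed points other than \<open>1\<close>. One step \<open>g \<mapsto> (1 i) \<circ> g\<close>
  destroys the fixed point \<open>i\<close> if \<open>g i = i\<close>, creates one if \<open>g i = 1\<close>, and otherwise leaves \<open>a\<close> unchanged.
  So \<open>a\<close> decreases with probability \<open>a / N\<close> and increases with probability \<open>1 / N\<close>, except while
  \<open>g 1 = 1\<close>, an event of probability at most \<open>1 / N\<close> after the first step. The process is thus an
  immigration-death chain up to a small error: with \<open>q = 1 - 1 / N\<close>, one step multiplies the
  generating function at \<open>1 + w\<close> by about \<open>exp (w / N)\<close> and replaces \<open>w\<close> by \<open>q w\<close>, with an error controlled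
  by the first two factorial moments of \<open>a\<close>. Iterating from \<open>a = N\<close> gives
  \<open>exp ((1 - q ^ t + N q ^ t) w)\<close>. At the time considered \<open>N q ^ t\<close> tends to \<open>exp (- c)\<close>, and
  Levy's continuity theorem applies.
\<close>

section \<open>One step of the walk, seen through the fixed leaves\<close>

abbreviation (input) star_walk :: "nat \<Rightarrow> nat \<Rightarrow> (nat \<Rightarrow> nat) pmf" where
  "star_walk n t \<equiv> conv_power (star_transposition_pmf n) t"

text \<open>The centre \<open>1\<close> is left out so that the count changes by at most one per
  step. The total number of fixed points can change by two, for instance on leaving the
  identity.\<close>

definition leaf_fixed_points :: "nat \<Rightarrow> (nat \<Rightarrow> nat) \<Rightarrow> nat" where
  "leaf_fixed_points n g = card {x \<in> {2..n}. g x = x}"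

lemma leaf_fixed_points_id: "leaf_fixed_points n id = n - 1"
proof -
  have "{x \<in> {2..n}. id x = x} = {2..n}" by auto
  then show ?thesis by (simp only: leaf_fixed_points_def card_atLeastAtMost)
qed

lemma num_fixed_points_eq_leaf_fixed_points:
  assumes "n \<ge> 1"
  shows "num_fixed_points n g = leaf_fixed_points n g + of_bool (g 1 = 1)"
proof -
  have "{x \<in> {1..n}. g x = x} = {x \<in> {2..n}. g x = x} \<union> (if g 1 = 1 then {1} else {})"
    using assms by (auto simp: Suc_le_eq numeral_2_eq_2 le_less)
  then show ?thesis
    by (simp add: num_fixed_points_def leaf_fixed_points_def card_insert_if)
qed

lemma star_transposition_pmf_eq_map:
  assumes "n \<ge> 2"
  shows "star_transposition_pmf n = map_pmf (Transposition.transpose 1) (pmf_of_set {2..n})"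
proof -
  have "inj_on (Transposition.transpose (1::nat)) {2..n}"
    by (rule inj_onI) (metis transpose_apply_first)
  moreover have "{Transposition.transpose 1 i | i. i \<in> {2..n}} = Transposition.transpose 1 ` {2..n}"
    by auto
  ultimately show ?thesis
    using assms by (simp add: star_transposition_pmf_def map_pmf_of_set_inj)
qed

lemma set_pmf_star_walk:
  assumes "n \<ge> 2"
  shows "set_pmf (star_walk n t) \<subseteq> {g. g permutes {1..n}}"
  using conv_power_star_permutes[OF assms] by blast

lemma finite_set_pmf_star_walk [simp]:
  assumes "n \<ge> 2"
  shows "finite (set_pmf (star_walk n t))"
  using finite_subset[OF set_pmf_star_walk[OF assms]] finite_permutations by blast

lemma integrable_star_walk [simp]:
  fixes f :: "(nat \<Rightarrow> nat) \<Rightarrow> 'b::{banach, second_countable_topology}"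
  assumes "n \<ge> 2"
  shows "integrable (star_walk n t) f"
  using assms by (intro integrable_measure_pmf_finite) auto

text \<open>Conditions on the state before the last step. The range of \<open>f\<close> is kept
  general because the identity serves both the real moments and the complex generating
  function.\<close>

lemma expectation_star_walk_Suc:
  fixes f :: "(nat \<Rightarrow> nat) \<Rightarrow> 'b::{banach, second_countable_topology}"
  assumes "n \<ge> 2"
  shows "measure_pmf.expectation (star_walk n (Suc t)) f =
    measure_pmf.expectation (star_walk n t)
      (\<lambda>g. (\<Sum>i\<in>{2..n}. f (Transposition.transpose 1 i \<circ> g)) /\<^sub>R (real n - 1))"
proof -
  have [simp]: "set_pmf (pmf_of_set {2..n}) = {2..n}"
    using assms by (intro set_pmf_of_set) auto
  have "measure_pmf.expectation (pmf_of_set {2..n}) (\<lambda>i. f (Transposition.transpose 1 i \<circ> g)) =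
      (\<Sum>i\<in>{2..n}. f (Transposition.transpose 1 i \<circ> g)) /\<^sub>R (real n - 1)" for g
    using assms
    by (subst integral_measure_pmf[of "{2..n}"]) (auto simp: of_nat_diff scaleR_sum_right divide_inverse)
  then have inner: "measure_pmf.expectation (map_pmf (\<lambda>h. h \<circ> g) (star_transposition_pmf n)) f =
      (\<Sum>i\<in>{2..n}. f (Transposition.transpose 1 i \<circ> g)) /\<^sub>R (real n - 1)" for g
    using assms by (simp add: star_transposition_pmf_eq_map)
  have finite_step: "finite (set_pmf (map_pmf (\<lambda>h. h \<circ> g) (star_transposition_pmf n)))" for g :: "nat \<Rightarrow> nat"
    using assms by (simp add: star_transposition_pmf_eq_map)
  show ?thesis
    unfolding conv_power.simps
    using assms
    by (subst pmf_expectation_bind[of "set_pmf (star_walk n t)"])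
       (auto simp only: inner finite_step finite_set_pmf_star_walk
          integral_measure_pmf[of "set_pmf (star_walk n t)"] subset_refl)
qed

text \<open>Only the leaf \<open>i\<close> can change status: any other leaf is left alone by the
  transposition, while \<open>i\<close> is fixed after the step exactly if
  \<open>g i = 1\<close>.\<close>

lemma leaf_fixed_points_transpose:
  assumes "i \<in> {2..n}"
  shows "leaf_fixed_points n (Transposition.transpose 1 i \<circ> g) =
    (if g i = i then leaf_fixed_points n g - 1
     else if g i = 1 then leaf_fixed_points n g + 1 else leaf_fixed_points n g)"
proof -
  let ?A = "{x \<in> {2..n}. g x = x}"
  have "{x \<in> {2..n}. (Transposition.transpose 1 i \<circ> g) x = x} =
    (if g i = i then ?A - {i} else if g i = 1 then insert i ?A else ?A)"
    using assms by (auto simp: Transposition.transpose_def split: if_splits)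
  then show ?thesis
    using assms by (simp add: leaf_fixed_points_def)
qed

text \<open>Deaths come from the \<open>a\<close> fixed leaves. A birth comes from the unique
  preimage of \<open>1\<close> under the bijection \<open>g\<close>, which is a leaf unless
  \<open>g 1 = 1\<close>. For \<open>a = 0\<close> the truncated \<open>a - 1\<close> is harmless,
  since its term has weight \<open>real a\<close>.\<close>

lemma sum_leaf_fixed_points_transpose:
  fixes \<phi> :: "nat \<Rightarrow> 'b::real_vector"
  assumes "g permutes {1..n}" "n \<ge> 2"
  defines "a \<equiv> leaf_fixed_points n g"
  shows "(\<Sum>i\<in>{2..n}. \<phi> (leaf_fixed_points n (Transposition.transpose 1 i \<circ> g))) =
    (real n - 1) *\<^sub>R \<phi> a + real a *\<^sub>R (\<phi> (a - 1) - \<phi> a)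
      + (if g 1 = 1 then 0 else \<phi> (a + 1) - \<phi> a)"
proof -
  have "(\<Sum>i\<in>{2..n}. \<phi> (leaf_fixed_points n (Transposition.transpose 1 i \<circ> g))) =
     (\<Sum>i\<in>{2..n}. \<phi> a + (if g i = i then \<phi> (a - 1) - \<phi> a else 0)
       + (if g i = 1 then \<phi> (a + 1) - \<phi> a else 0))"
    by (rule sum.cong) (auto simp: leaf_fixed_points_transpose a_def simp del: One_nat_def)
  also have "\<dots> = (real n - 1) *\<^sub>R \<phi> a + real a *\<^sub>R (\<phi> (a - 1) - \<phi> a)
      + (\<Sum>i\<in>{x\<in>{2..n}. g x = 1}. \<phi> (a + 1) - \<phi> a)"
    using assms(2)
    by (simp add: sum.distrib sum.inter_filter[symmetric] a_def leaf_fixed_points_def sum_constant_scaleR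
        of_nat_diff del: sum_constant)
  also have "(\<Sum>i\<in>{x\<in>{2..n}. g x = 1}. \<phi> (a + 1) - \<phi> a) =
      (if g 1 = 1 then 0 else \<phi> (a + 1) - \<phi> a)"
  proof (cases "g 1 = 1")
    case True
    then have "g x = 1 \<longleftrightarrow> x = 1" for x
      using inj_eq[OF permutes_inj[OF assms(1)], of x 1] by simp
    then have "{x\<in>{2..n}. g x = 1} = {}" by auto
    with True show ?thesis by (simp only: sum.empty if_True simp_thms)
  next
    case False
    obtain y where y: "g y = 1"
      using permutes_surj[OF assms(1)] by (metis surjD)
    then have "y \<in> {1..n}"
      using assms(2) permutes_in_image[OF assms(1), of y] by simp
    moreover have "y \<noteq> 1" using y False by metis
    ultimately have "y \<in> {2..n}" by auto
    moreover have "g x = 1 \<longleftrightarrow> x = y" for x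
      using inj_eq[OF permutes_inj[OF assms(1)], of x y] y by simp
    ultimately have "{x\<in>{2..n}. g x = 1} = {y}" by auto
    with False show ?thesis by (simp only: sum.insert finite.emptyI empty_iff not_False_eq_True sum.empty if_False add_0_right)
  qed
  finally show ?thesis .
qed

lemma expectation_leaf_fixed_points_Suc:
  fixes \<phi> :: "nat \<Rightarrow> 'b::{banach, second_countable_topology}"
  assumes "n \<ge> 2"
  shows "measure_pmf.expectation (star_walk n (Suc t)) (\<lambda>g. \<phi> (leaf_fixed_points n g)) =
    measure_pmf.expectation (star_walk n t) (\<lambda>g. let a = leaf_fixed_points n g in
      \<phi> a + (real a *\<^sub>R (\<phi> (a - 1) - \<phi> a) + (if g 1 = 1 then 0 else \<phi> (a + 1) - \<phi> a)) /\<^sub>R (real n - 1))"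
proof -
  have cancel: "((real n - 1) *\<^sub>R x + u + v) /\<^sub>R (real n - 1) = x + (u + v) /\<^sub>R (real n - 1)" for x u v :: 'b
    using assms by (simp add: scaleR_add_right add.assoc)
  have "AE g in star_walk n t. g permutes {1..n}"
    using set_pmf_star_walk[OF assms] by (auto simp: AE_measure_pmf_iff)
  then show ?thesis
    unfolding expectation_star_walk_Suc[OF assms]
  proof (intro integral_cong_AE, goal_cases)
    case 3
    then show ?case
    proof eventually_elim
      case (elim g)
      show ?case
        unfolding sum_leaf_fixed_points_transpose[OF elim assms] Let_def
        using cancel by blast
    qed
  qed auto
qed

section \<open>The event that the centre is fixed\<close>

text \<open>The step \<open>(1 i)\<close> makes \<open>1\<close> a fixed point only for
  \<open>i = g 1\<close>, so at most one of the \<open>n - 1\<close> choices does. At time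
  \<open>0\<close> the centre is fixed with certainty, hence \<open>Suc t\<close>.\<close>

lemma prob_star_walk_fixes_centre_Suc_le:
  assumes "n \<ge> 2"
  shows "measure_pmf.expectation (star_walk n (Suc t)) (\<lambda>g. of_bool (g 1 = 1)) \<le> 1 / (real n - 1)"
proof -
  have "(\<Sum>i\<in>{2..n}. of_bool ((Transposition.transpose 1 i \<circ> g) 1 = 1)) \<le> (1::real)" for g :: "nat \<Rightarrow> nat"
  proof -
    have "(\<Sum>i\<in>{2..n}. of_bool ((Transposition.transpose 1 i \<circ> g) 1 = 1)) =
        (\<Sum>i\<in>{2..n}. if i = g 1 then 1 else 0::real)"
      by (rule sum.cong) (auto simp: Transposition.transpose_def)
    also have "\<dots> \<le> 1" by simp
    finally show ?thesis .
  qed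
  then have "measure_pmf.expectation (star_walk n (Suc t)) (\<lambda>g. of_bool (g 1 = 1)) \<le>
      measure_pmf.expectation (star_walk n t) (\<lambda>g. 1 / (real n - 1))"
    unfolding expectation_star_walk_Suc[OF assms]
    using assms by (intro integral_mono) (auto simp: divide_simps simp del: sum.delta sum.delta' o_apply)
  then show ?thesis by simp
qed

text \<open>This controls the expected number of times before \<open>t\<close> at which immigration
  is blocked. The summand \<open>1\<close> pays for time \<open>0\<close>.\<close>

lemma sum_prob_star_walk_fixes_centre_le:
  assumes "n \<ge> 2"
  shows "(\<Sum>s<t. measure_pmf.expectation (star_walk n s) (\<lambda>g. of_bool (g 1 = 1)))
    \<le> 1 + real t / (real n - 1)"
proof (induction t)
  case (Suc t)
  have "measure_pmf.expectation (star_walk n t) (\<lambda>g. of_bool (g 1 = 1))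
      \<le> of_bool (t = 0) + 1 / (real n - 1)"
  proof (cases t)
    case (Suc s)
    show ?thesis unfolding Suc
      using prob_star_walk_fixes_centre_Suc_le[OF assms, of s] by simp
  qed (use assms in auto)
  with Suc show ?case
    using assms by (cases "t = 0") (auto simp: add_divide_distrib)
qed auto

section \<open>Bounds for the first two factorial moments\<close>

text \<open>The immigration-death chain started at \<open>N\<close> has mean
  \<open>1 - q ^ t + N * q ^ t\<close>; here the term \<open>- q ^ t\<close> is dropped. The result
  obeys the same affine recursion, with fixed point \<open>1\<close>.\<close>

definition mean_bound :: "nat \<Rightarrow> nat \<Rightarrow> real" where
  "mean_bound n t = 1 + (real n - 1) * (1 - 1 / (real n - 1)) ^ t"

lemma mean_bound_ge_1: "n \<ge> 2 \<Longrightarrow> mean_bound n t \<ge> 1"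
  by (auto simp: mean_bound_def)

lemma mean_bound_Suc:
  assumes "n \<ge> 2"
  shows "mean_bound n (Suc t) = mean_bound n t - (mean_bound n t - 1) / (real n - 1)"
  using assms by (simp add: mean_bound_def field_simps)

text \<open>The mean would follow \<open>m \<mapsto> q * m + 1 / N\<close> exactly if immigration
  were never blocked; blocking can only lower it.\<close>

lemma expectation_leaf_fixed_points_le:
  assumes "n \<ge> 2"
  shows "measure_pmf.expectation (star_walk n t) (\<lambda>g. real (leaf_fixed_points n g)) \<le> mean_bound n t"
proof (induction t)
  case 0
  have "leaf_fixed_points n id = n - 1"
    by (rule leaf_fixed_points_id)
  then show ?case using assms by (simp add: mean_bound_def)
next
  case (Suc t)
  let ?N = "real n - 1"
  let ?E = "measure_pmf.expectation (star_walk n t)"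
  have N: "?N \<ge> 1" using assms by auto
  have "measure_pmf.expectation (star_walk n (Suc t)) (\<lambda>g. real (leaf_fixed_points n g)) \<le>
     ?E (\<lambda>g. (1 - 1 / ?N) * real (leaf_fixed_points n g) + 1 / ?N)"
    unfolding expectation_leaf_fixed_points_Suc[OF assms, where \<phi> = real]
  proof (rule integral_mono)
    fix g :: "nat \<Rightarrow> nat"
    show "(let a = leaf_fixed_points n g in
      real a + (real a *\<^sub>R (real (a - 1) - real a) + (if g 1 = 1 then 0 else real (a + 1) - real a)) /\<^sub>R ?N)
       \<le> (1 - 1 / ?N) * real (leaf_fixed_points n g) + 1 / ?N"
      using N by (cases "leaf_fixed_points n g") (auto simp: Let_def field_simps)
  qed (use assms in auto)
  also have "\<dots> = (1 - 1 / ?N) * ?E (\<lambda>g. real (leaf_fixed_points n g)) + 1 / ?N"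
    using assms by simp
  also have "\<dots> \<le> (1 - 1 / ?N) * mean_bound n t + 1 / ?N"
    using N by (intro add_mono mult_left_mono Suc) auto
  also have "\<dots> = mean_bound n (Suc t)"
    using mean_bound_Suc[OF assms, of t] N by (simp add: field_simps)
  finally show ?case .
qed

text \<open>For \<open>X = a (a - 1)\<close>, deaths contribute exactly \<open>- 2 X / N\<close> to
  the mean increment and immigration at most \<open>2 a / N\<close>, so the recursion closes with
  the bound on the mean. The condition \<open>n \<ge> 3\<close> makes the coefficient
  \<open>1 - 2 / N\<close> nonnegative.\<close>

lemma expectation_leaf_fixed_points_falling2_le:
  assumes "n \<ge> 3"
  shows "measure_pmf.expectation (star_walk n t)
      (\<lambda>g. real (leaf_fixed_points n g) * (real (leaf_fixed_points n g) - 1)) \<le> (mean_bound n t)\<^sup>2"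
proof (induction t)
  case 0
  have "leaf_fixed_points n id = n - 1"
    by (rule leaf_fixed_points_id)
  moreover have "(real n - 1) * (real n - 2) \<le> (real n)\<^sup>2"
    using assms by (simp add: power2_eq_square field_simps)
  ultimately show ?case using assms by (simp add: mean_bound_def of_nat_diff algebra_simps)
next
  case (Suc t)
  let ?N = "real n - 1" and ?L = "mean_bound n t"
  let ?E = "measure_pmf.expectation (star_walk n t)"
  let ?a = "\<lambda>g. real (leaf_fixed_points n g)"
  have n: "n \<ge> 2" and N: "?N \<ge> 2" using assms by auto
  have "measure_pmf.expectation (star_walk n (Suc t)) (\<lambda>g. ?a g * (?a g - 1)) \<le>
     ?E (\<lambda>g. (1 - 2 / ?N) * (?a g * (?a g - 1)) + 2 / ?N * ?a g)"
    unfolding expectation_leaf_fixed_points_Suc[OF n, where \<phi> = "\<lambda>a. real a * (real a - 1)"]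
  proof (rule integral_mono)
    fix g :: "nat \<Rightarrow> nat"
    show "(let a = leaf_fixed_points n g in
      real a * (real a - 1) + (real a *\<^sub>R (real (a - 1) * (real (a - 1) - 1) - real a * (real a - 1))
        + (if g 1 = 1 then 0 else real (a + 1) * (real (a + 1) - 1) - real a * (real a - 1))) /\<^sub>R ?N)
       \<le> (1 - 2 / ?N) * (?a g * (?a g - 1)) + 2 / ?N * ?a g"
    proof -
      define a where "a = leaf_fixed_points n g"
      define X where "X = real a * (real a - 1)"
      define Y where "Y = real a * (real (a - 1) * (real (a - 1) - 1) - X)
        + (if g 1 = 1 then 0 else real (a + 1) * (real (a + 1) - 1) - X)"
      have "Y \<le> - 2 * X + 2 * real a"
        by (cases a) (auto simp: X_def Y_def algebra_simps)
      then have "Y / ?N \<le> (- 2 * X + 2 * real a) / ?N"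
        using N by (intro divide_right_mono) auto
      then show ?thesis
        unfolding Let_def a_def[symmetric] X_def[symmetric] Y_def[symmetric] real_scaleR_def
        by (simp add: algebra_simps add_divide_distrib diff_divide_distrib divide_inverse Y_def)
    qed
  qed (use n in auto)
  also have "\<dots> = (1 - 2 / ?N) * ?E (\<lambda>g. ?a g * (?a g - 1)) + 2 / ?N * ?E ?a"
    using n by simp
  also have "\<dots> \<le> (1 - 2 / ?N) * ?L\<^sup>2 + 2 / ?N * ?L"
    using N expectation_leaf_fixed_points_le[OF n] by (intro add_mono mult_left_mono Suc) auto
  also have "\<dots> \<le> (?L - (?L - 1) / ?N)\<^sup>2"
  proof -
    \<comment> \<open>The square of the next mean bound exceeds the recursion by a perfect
      square.\<close>
    have "(?L - (?L - 1) / ?N)\<^sup>2 - ((1 - 2 / ?N) * ?L\<^sup>2 + 2 / ?N * ?L) = ((?L - 1) / ?N)\<^sup>2"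
      by (simp add: power2_eq_square divide_inverse algebra_simps)
    then show ?thesis by (smt (verit) zero_le_power2)
  qed
  also have "\<dots> = (mean_bound n (Suc t))\<^sup>2"
    using mean_bound_Suc[OF n, of t] by simp
  finally show ?case .
qed

section \<open>Elementary estimates for powers and exponentials\<close>

text \<open>A second-order Taylor remainder on the unit ball. Its coefficient is half the second
  falling factorial of \<open>a\<close>, which is why the second factorial moment enters the
  error.\<close>

lemma norm_power_linearisation_le:
  fixes x y :: "'a::{comm_ring_1,real_normed_algebra_1}"
  assumes "norm x \<le> 1" "norm y \<le> 1"
  shows "norm (x ^ a - y ^ a - of_nat a * (x - y) * y ^ (a - 1)) \<le> real a * (real a - 1) / 2 * (norm (x - y))\<^sup>2"
proof (induction a)
  case (Suc a)
  let ?R = "x ^ a - y ^ a - of_nat a * (x - y) * y ^ (a - 1)"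
  \<comment> \<open>Each further factor multiplies the old remainder by \<open>x\<close> and adds a
    term of norm at most \<open>a * (norm (x - y))\<^sup>2\<close>; these coefficients sum to
    \<open>a (a - 1) / 2\<close>.\<close>
  have "x ^ Suc a - y ^ Suc a - of_nat (Suc a) * (x - y) * y ^ (Suc a - 1)
      = x * ?R + of_nat a * (x - y)\<^sup>2 * y ^ (a - 1)"
    by (cases a) (simp_all add: algebra_simps power2_eq_square)
  also have "norm \<dots> \<le> norm (x * ?R) + norm (of_nat a * (x - y)\<^sup>2 * y ^ (a - 1))"
    by (rule norm_triangle_ineq)
  also have "norm (x * ?R) \<le> 1 * norm ?R"
    by (intro order.trans[OF norm_mult_ineq] mult_right_mono assms norm_ge_zero)
  also have "norm (of_nat a * (x - y)\<^sup>2 * y ^ (a - 1)) \<le> real a * (norm (x - y))\<^sup>2 * 1"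
  proof -
    have y: "norm (y ^ (a - 1)) \<le> 1"
      by (rule order.trans[OF norm_power_ineq]) (use assms in \<open>auto intro: power_le_one\<close>)
    have xy: "norm (of_nat a * (x - y)\<^sup>2) \<le> real a * (norm (x - y))\<^sup>2"
      using norm_power_ineq[of "x - y" 2]
      by (intro order.trans[OF norm_mult_ineq]) (simp add: mult_left_mono)
    show ?thesis
      by (intro order.trans[OF norm_mult_ineq] mult_mono' xy y norm_ge_zero)
  qed
  also have "1 * norm ?R + real a * (norm (x - y))\<^sup>2 * 1 \<le>
      real a * (real a - 1) / 2 * (norm (x - y))\<^sup>2 + real a * (norm (x - y))\<^sup>2"
    using Suc by simp
  also have "\<dots> = real (Suc a) * (real (Suc a) - 1) / 2 * (norm (x - y))\<^sup>2"
    by (simp add: field_simps)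
  finally show ?case by simp
qed auto

lemma norm_exp_minus_linear_le:
  fixes w :: complex
  assumes "norm w \<le> 2"
  shows "norm (exp w - 1 - w) \<le> exp 2 * (norm w)\<^sup>2"
proof -
  have "norm (exp w - (1 + w)) \<le> exp (norm w) * (norm w)\<^sup>2"
    using Taylor_exp_field[of w 1] by (simp add: power2_eq_square)
  also have "\<dots> \<le> exp 2 * (norm w)\<^sup>2"
    using assms by (intro mult_right_mono) auto
  finally show ?thesis by (simp add: algebra_simps)
qed

text \<open>\<open>1 + r * w\<close> is a convex combination of \<open>1\<close> and
  \<open>1 + w\<close>. Hence replacing \<open>w\<close> by \<open>q * w\<close> stays in the disc,
  and the one-step estimate can be iterated.\<close>

lemma norm_one_plus_scaled_le_one:
  fixes w :: complex
  assumes "norm (1 + w) \<le> 1" "0 \<le> r" "r \<le> 1"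
  shows "norm (1 + of_real r * w) \<le> 1"
proof -
  have "1 + of_real r * w = of_real (1 - r) + of_real r * (1 + w)"
    by (simp add: algebra_simps)
  also have "norm \<dots> \<le> norm (of_real (1 - r) :: complex) + norm (of_real r * (1 + w))"
    by (rule norm_triangle_ineq)
  also have "\<dots> \<le> (1 - r) + r * 1"
    using assms by (intro add_mono) (auto simp: norm_mult simp del: of_real_diff intro: mult_left_le)
  finally show ?thesis by simp
qed

lemma norm_le_2_if_norm_one_plus_le_1:
  fixes w :: complex
  assumes "norm (1 + w) \<le> 1"
  shows "norm w \<le> 2"
  using norm_triangle_ineq4[of "1 + w" 1] assms by simp

text \<open>In this disc \<open>Re w \<le> 0\<close>.\<close>

lemma norm_exp_le_1_if_norm_one_plus_le_1:
  fixes w :: complex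
  assumes "norm (1 + w) \<le> 1" "r \<ge> 0"
  shows "norm (exp (of_real r * w)) \<le> 1"
  using complex_Re_le_cmod[of "1 + w"] assms by (simp add: mult_nonneg_nonpos)

section \<open>The generating function: one step and its iteration\<close>

text \<open>The death term equals \<open>- a * d * (1 + w) ^ (a - 1)\<close>, the linear part of
  shifting the base by \<open>- d\<close>. Immigration contributes \<open>d * (1 + w) ^ a\<close>,
  the linear part of multiplying by \<open>exp d\<close>. The flag \<open>b\<close> stands for
  \<open>g 1 = 1\<close> and costs one lost immigration term.\<close>

lemma norm_leaf_power_step_le:
  fixes w d :: complex
  assumes "norm (1 + w) \<le> 1" "norm (1 + w - d) \<le> 1" "norm d \<le> 2" "d = w / of_real N" "N > 0"
  shows "norm ((1 + w) ^ a + (real a *\<^sub>R ((1 + w) ^ (a - 1) - (1 + w) ^ a)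
      + (if b then 0 else (1 + w) ^ (a + 1) - (1 + w) ^ a)) /\<^sub>R N - exp d * (1 + w - d) ^ a)
    \<le> exp 2 * (norm d)\<^sup>2 * (real a * (real a - 1) + real a + 1) + norm d * of_bool b"
proof -
  define x y where "x = 1 + w - d" and "y = 1 + w"
  have w: "w = of_real N * d" using assms(4,5) by simp
  have norm_xy: "norm x \<le> 1" "norm y \<le> 1" and xy: "x - y = - d"
    using assms by (auto simp: x_def y_def)
  define R where "R = x ^ a - y ^ a - of_nat a * (x - y) * y ^ (a - 1)"
  have "of_nat a * (y ^ (a - 1) - y ^ a) = - of_nat a * w * y ^ (a - 1)"
    by (cases a) (simp_all add: y_def algebra_simps)
  then have down: "(real a *\<^sub>R (y ^ (a - 1) - y ^ a)) /\<^sub>R N = - of_nat a * d * y ^ (a - 1)"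
    using assms(5) by (simp add: scaleR_conv_of_real w)
  have up: "(if b then 0 else y ^ (a + 1) - y ^ a) /\<^sub>R N = d * y ^ a - of_bool b * d * y ^ a"
    using assms(5) by (simp add: scaleR_conv_of_real y_def w algebra_simps)
  \<comment> \<open>The four errors are the Taylor remainder of the power, the mismatch of bases in
    the immigration term, the blocked immigration, and the Taylor remainder of
    \<open>exp\<close>.\<close>
  have "y ^ a + (real a *\<^sub>R (y ^ (a - 1) - y ^ a) + (if b then 0 else y ^ (a + 1) - y ^ a)) /\<^sub>R N - exp d * x ^ a
      = - R + d * (y ^ a - x ^ a) - of_bool b * d * y ^ a - (exp d - 1 - d) * x ^ a"
    unfolding scaleR_add_right down up R_def xy by (simp add: algebra_simps)
  also have "norm \<dots> \<le> norm R + norm (d * (y ^ a - x ^ a)) + norm (of_bool b * d * y ^ a)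
      + norm ((exp d - 1 - d) * x ^ a)"
    by (smt (verit) norm_triangle_ineq norm_triangle_ineq4 norm_minus_cancel)
  also have "\<dots> \<le> real a * (real a - 1) / 2 * (norm d)\<^sup>2 + norm d * (real a * norm d)
      + norm d * of_bool b + exp 2 * (norm d)\<^sup>2"
  proof (intro add_mono)
    show "norm R \<le> real a * (real a - 1) / 2 * (norm d)\<^sup>2"
      using norm_power_linearisation_le[OF norm_xy, of a] by (simp add: R_def xy)
    show "norm (d * (y ^ a - x ^ a)) \<le> norm d * (real a * norm d)"
      using norm_power_diff[OF norm_xy(2,1), of a] xy
      by (simp add: norm_mult mult_left_mono norm_minus_commute)
    show "norm (of_bool b * d * y ^ a) \<le> norm d * of_bool b"
      using norm_xy by (simp add: norm_mult norm_power power_le_one mult_left_le)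
    have "norm ((exp d - 1 - d) * x ^ a) \<le> norm (exp d - 1 - d)"
      using norm_xy by (simp add: norm_mult norm_power power_le_one mult_left_le)
    also have "\<dots> \<le> exp 2 * (norm d)\<^sup>2"
      by (rule norm_exp_minus_linear_le) fact
    finally show "norm ((exp d - 1 - d) * x ^ a) \<le> exp 2 * (norm d)\<^sup>2" .
  qed
  also have "\<dots> = (norm d)\<^sup>2 * (real a * (real a - 1) / 2 + real a + exp 2) + norm d * of_bool b"
    by (simp add: algebra_simps power2_eq_square)
  also have "\<dots> \<le> (norm d)\<^sup>2 * (exp 2 * (real a * (real a - 1) + real a + 1)) + norm d * of_bool b"
  proof (intro add_mono mult_left_mono order.refl)
    have *: "u / 2 + v + r \<le> r * (u + v + 1)" if "u \<ge> 0" "v \<ge> 0" "r \<ge> 1" for u v r :: real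
    proof -
      have "r * (u + v + 1) - (u / 2 + v + r) = (r - 1) * (u + v) + u / 2"
        by (simp add: algebra_simps)
      moreover have "(r - 1) * (u + v) \<ge> 0" using that by simp
      ultimately show ?thesis using that(1) by linarith
    qed
    have "real a * (real a - 1) \<ge> 0" by (cases a) auto
    then show "real a * (real a - 1) / 2 + real a + exp 2 \<le> exp 2 * (real a * (real a - 1) + real a + 1)"
      by (intro *) auto
  qed auto
  finally show ?thesis
    by (simp only: x_def y_def mult.left_commute[of _ "exp 2"] mult.assoc)
qed

text \<open>Averages the pointwise estimate, using \<open>w - w / N = q * w\<close>. The factor
  \<open>3\<close> arises because the factorial moments of orders 0, 1 and 2 are each bounded by the
  square of \<open>mean_bound n t\<close>.\<close>

lemma norm_expectation_leaf_power_Suc_le: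
  fixes w :: complex
  assumes "n \<ge> 3" "norm (1 + w) \<le> 1"
  shows "norm (measure_pmf.expectation (star_walk n (Suc t)) (\<lambda>g. (1 + w) ^ leaf_fixed_points n g)
      - exp (w / of_real (real n - 1)) * measure_pmf.expectation (star_walk n t)
          (\<lambda>g. (1 + of_real (1 - 1 / (real n - 1)) * w) ^ leaf_fixed_points n g))
    \<le> 3 * exp 2 * (norm w * mean_bound n t / (real n - 1))\<^sup>2
      + norm w / (real n - 1) * measure_pmf.expectation (star_walk n t) (\<lambda>g. of_bool (g 1 = 1))"
proof -
  let ?E = "measure_pmf.expectation (star_walk n t)" and ?a = "\<lambda>g. real (leaf_fixed_points n g)"
  let ?E' = "measure_pmf.expectation (star_walk n t) :: _ \<Rightarrow> complex"
  define N where "N = real n - 1"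
  define d where "d = w / of_real N"
  define L where "L = mean_bound n t"
  have n: "n \<ge> 2" and N: "N \<ge> 2" using assms by (auto simp: N_def)
  have norm_d: "norm d = norm w / N" using N by (simp add: d_def norm_divide)
  have L: "L \<ge> 1" using mean_bound_ge_1[OF n] by (simp add: L_def)
  have contract: "1 + of_real (1 - 1 / N) * w = 1 + w - d"
    by (simp add: d_def algebra_simps)
  have norm_1d: "norm (1 + w - d) \<le> 1"
    unfolding contract[symmetric] using N by (intro norm_one_plus_scaled_le_one assms) auto
  have "norm w / N \<le> 2 / 1"
    using norm_le_2_if_norm_one_plus_le_1[OF assms(2)] N by (intro frac_le) auto
  then have d2: "norm d \<le> 2" by (simp add: norm_d)
  define \<psi> where "\<psi> g = (let a = leaf_fixed_points n g in
      (1 + w) ^ a + (real a *\<^sub>R ((1 + w) ^ (a - 1) - (1 + w) ^ a)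
      + (if g 1 = 1 then 0 else (1 + w) ^ (a + 1) - (1 + w) ^ a)) /\<^sub>R N)
      - exp d * (1 + w - d) ^ leaf_fixed_points n g" for g
  have "measure_pmf.expectation (star_walk n (Suc t)) (\<lambda>g. (1 + w) ^ leaf_fixed_points n g)
      - exp d * ?E' (\<lambda>g. (1 + w - d) ^ leaf_fixed_points n g) = ?E' \<psi>"
    unfolding expectation_leaf_fixed_points_Suc[OF n, where \<phi> = "\<lambda>a. (1 + w) ^ a"] \<psi>_def N_def[symmetric]
    by (subst Bochner_Integration.integral_diff) (use n in auto)
  also have "norm \<dots> \<le> ?E (\<lambda>g. norm (\<psi> g))"
    by (rule integral_norm_bound)
  also have "\<dots> \<le> ?E (\<lambda>g. exp 2 * (norm d)\<^sup>2 * (?a g * (?a g - 1) + ?a g + 1) + norm d * of_bool (g 1 = 1))"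
    unfolding \<psi>_def Let_def
    by (intro integral_mono integrable_star_walk n norm_leaf_power_step_le assms norm_1d d2 d_def) (use N in auto)
  also have "\<dots> = exp 2 * (norm d)\<^sup>2 * (?E (\<lambda>g. ?a g * (?a g - 1)) + ?E ?a + 1)
      + norm d * ?E (\<lambda>g. of_bool (g 1 = 1))"
    using n by simp
  also have "\<dots> \<le> exp 2 * (norm d)\<^sup>2 * (L\<^sup>2 + L\<^sup>2 + L\<^sup>2) + norm d * ?E (\<lambda>g. of_bool (g 1 = 1))"
  proof (intro add_mono mult_left_mono order.refl)
    show "?E (\<lambda>g. ?a g * (?a g - 1)) \<le> L\<^sup>2"
      unfolding L_def by (rule expectation_leaf_fixed_points_falling2_le[OF assms(1)])
    have "?E ?a \<le> L" unfolding L_def by (rule expectation_leaf_fixed_points_le[OF n])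
    also have "L \<le> L\<^sup>2" using L by (simp add: self_le_power)
    finally show "?E ?a \<le> L\<^sup>2" .
    show "1 \<le> L\<^sup>2" using L by (rule one_le_power)
  qed auto
  also have "exp 2 * (norm d)\<^sup>2 * (L\<^sup>2 + L\<^sup>2 + L\<^sup>2) = 3 * exp 2 * (norm w * L / N)\<^sup>2"
    by (simp add: norm_d power_mult_distrib power_divide)
  finally show ?thesis
    unfolding contract[symmetric] norm_d unfolding d_def N_def L_def .
qed

text \<open>Induction with \<open>w\<close> arbitrary, since a step evaluates the previous
  generating function at \<open>q * w\<close>. The three errors come from the initial state, from
  \<open>t\<close> linearisations, and from blocked immigration. Although the mean starts near
  \<open>n\<close>, early steps see a strongly contracted \<open>w\<close>, so only the final
  \<open>mean_bound n t\<close> appears.\<close>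

lemma norm_expectation_leaf_power_minus_exp_le:
  fixes w :: complex
  assumes "n \<ge> 3" "norm (1 + w) \<le> 1"
  defines "N \<equiv> real n - 1"
  defines "q \<equiv> 1 - 1 / N"
  shows "norm (measure_pmf.expectation (star_walk n t) (\<lambda>g. (1 + w) ^ leaf_fixed_points n g)
      - exp (of_real (1 - q ^ t + N * q ^ t) * w))
    \<le> exp 2 * N * (norm w * q ^ t)\<^sup>2 + 3 * exp 2 * real t * (norm w * mean_bound n t / (q * N))\<^sup>2
      + norm w / N * (\<Sum>s<t. measure_pmf.expectation (star_walk n s) (\<lambda>g. of_bool (g 1 = 1)))"
  using assms(2)
proof (induction t arbitrary: w)
  case 0
  have n: "n \<ge> 2" and N: "N \<ge> 2" using assms(1) by (auto simp: N_def)
  \<comment> \<open>At the identity the generating function is \<open>(1 + w) ^ N\<close>; both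
    bases lie in the unit disc, so the powers differ by at most \<open>N\<close> times the
    difference of the bases.\<close>
  have "norm ((1 + w) ^ (n - 1) - exp w ^ (n - 1)) \<le> real (n - 1) * norm (1 + w - exp w)"
    using norm_exp_le_1_if_norm_one_plus_le_1[OF 0, of 1] 0 by (intro norm_power_diff) auto
  also have "\<dots> = N * norm (exp w - 1 - w)"
    using n by (simp add: N_def of_nat_diff norm_minus_commute diff_diff_eq)
  also have "\<dots> \<le> N * (exp 2 * (norm w)\<^sup>2)"
    using N by (intro mult_left_mono norm_exp_minus_linear_le norm_le_2_if_norm_one_plus_le_1 0) auto
  finally show ?case
    using n by (simp add: leaf_fixed_points_id N_def exp_of_nat_mult[symmetric] of_nat_diff mult_ac)
next
  case (Suc t)
  let ?E = "\<lambda>t w. measure_pmf.expectation (star_walk n t) (\<lambda>g. (1 + w) ^ leaf_fixed_points n g) :: complex"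
  let ?P = "\<lambda>s. measure_pmf.expectation (star_walk n s) (\<lambda>g. of_bool (g 1 = 1)) :: real"
  let ?L = "mean_bound n"
  have n: "n \<ge> 2" and N: "N \<ge> 2" using assms(1) by (auto simp: N_def)
  have q: "0 < q" "q \<le> 1" using N by (auto simp: q_def)
  have L: "?L t \<ge> 1" using mean_bound_ge_1[OF n] .
  \<comment> \<open>The bound decays by at most a factor \<open>q\<close> per step, which the
    contraction of \<open>w\<close> compensates; this is the source of \<open>q * N\<close> in the
    denominator.\<close>
  have qL: "q * ?L t \<le> ?L (Suc t)"
    using q by (simp add: mean_bound_def N_def[symmetric] q_def[symmetric] algebra_simps)
  define w' where "w' = of_real q * w"
  have norm_w': "norm w' = q * norm w" using q by (simp add: w'_def norm_mult)
  have w': "norm (1 + w') \<le> 1"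
    unfolding w'_def using q Suc.prems by (intro norm_one_plus_scaled_le_one) auto
  have exp_eq: "exp (w / of_real N) * exp (of_real (1 - q ^ t + N * q ^ t) * w')
      = exp (of_real (1 - q ^ Suc t + N * q ^ Suc t) * w)"
  proof -
    \<comment> \<open>The exponents compose because \<open>1 / N = 1 - q\<close>.\<close>
    have "1 / N + (1 - q ^ t + N * q ^ t) * q = 1 - q ^ Suc t + N * q ^ Suc t"
      by (simp add: q_def algebra_simps)
    then have "of_real (1 / N) + of_real (1 - q ^ t + N * q ^ t) * of_real q
       = (of_real (1 - q ^ Suc t + N * q ^ Suc t) :: complex)"
      by (metis of_real_add of_real_mult)
    moreover have "w / of_real N + of_real (1 - q ^ t + N * q ^ t) * w' =
        (of_real (1 / N) + of_real (1 - q ^ t + N * q ^ t) * of_real q) * w"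
      by (simp add: w'_def algebra_simps)
    ultimately show ?thesis by (simp only: exp_add[symmetric])
  qed
  have norm_exp_wN: "norm (exp (w / of_real N)) \<le> 1"
    using norm_exp_le_1_if_norm_one_plus_le_1[OF Suc.prems, of "1 / N"] N by (simp add: divide_inverse mult.commute)
  have "norm (?E (Suc t) w - exp (of_real (1 - q ^ Suc t + N * q ^ Suc t) * w)) =
      norm ((?E (Suc t) w - exp (w / of_real N) * ?E t w')
        + exp (w / of_real N) * (?E t w' - exp (of_real (1 - q ^ t + N * q ^ t) * w')))"
    unfolding exp_eq[symmetric] by (simp add: algebra_simps)
  also have "\<dots> \<le> norm (?E (Suc t) w - exp (w / of_real N) * ?E t w')
        + 1 * norm (?E t w' - exp (of_real (1 - q ^ t + N * q ^ t) * w'))"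
    using norm_exp_wN
    by (intro order.trans[OF norm_triangle_ineq] add_mono) (auto simp: norm_mult intro: mult_left_le_one_le)
  also have "\<dots> \<le> (3 * exp 2 * (norm w * ?L t / N)\<^sup>2 + norm w / N * ?P t)
      + 1 * (exp 2 * N * (norm w' * q ^ t)\<^sup>2 + 3 * exp 2 * real t * (norm w' * ?L t / (q * N))\<^sup>2
      + norm w' / N * (\<Sum>s<t. ?P s))"
    using norm_expectation_leaf_power_Suc_le[OF assms(1) Suc.prems, of t] Suc.IH[OF w']
    by (intro add_mono mult_left_mono) (auto simp: w'_def N_def q_def)
  also have "\<dots> \<le> (3 * exp 2 * (norm w * ?L (Suc t) / (q * N))\<^sup>2 + norm w / N * ?P t)
      + 1 * (exp 2 * N * (norm w * q ^ Suc t)\<^sup>2 + 3 * exp 2 * real t * (norm w * ?L (Suc t) / (q * N))\<^sup>2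
      + norm w / N * (\<Sum>s<t. ?P s))"
  proof -
    have "norm w * ?L t / N = norm w * (q * ?L t) / (q * N)"
      using q by simp
    also have "\<dots> \<le> norm w * ?L (Suc t) / (q * N)"
      using q N qL by (intro divide_right_mono mult_left_mono) auto
    finally have le: "norm w * ?L t / N \<le> norm w * ?L (Suc t) / (q * N)" .
    have eq: "norm w' * ?L t / (q * N) = norm w * ?L t / N"
      using q by (simp add: norm_w')
    have sq: "(norm w * ?L t / N)\<^sup>2 \<le> (norm w * ?L (Suc t) / (q * N))\<^sup>2"
      using le L N by (intro power_mono) auto
    have weq: "norm w' * q ^ t = norm w * q ^ Suc t" by (simp add: norm_w' mult_ac)
    have "norm w' / N * (\<Sum>s<t. ?P s) \<le> norm w / N * (\<Sum>s<t. ?P s)"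
      using q N by (intro mult_right_mono divide_right_mono sum_nonneg) (auto simp: norm_w' mult_left_le_one_le)
    moreover have "0 \<le> norm w / N" using N by simp
    ultimately show ?thesis
      unfolding eq weq using sq N by (intro add_mono mult_left_mono) auto
  qed
  also have "\<dots> = exp 2 * N * (norm w * q ^ Suc t)\<^sup>2 + 3 * exp 2 * real (Suc t) * (norm w * ?L (Suc t) / (q * N))\<^sup>2
      + norm w / N * (\<Sum>s<Suc t. ?P s)"
    by (simp add: algebra_simps add_divide_distrib)
  finally show ?case .
qed

section \<open>Asymptotics at the chosen time\<close>

text \<open>Eventually the argument of the floor is at least \<open>1\<close>, so \<open>nat\<close>
  does not truncate. Positivity later allows a last step to be split off.\<close>

lemma walk_steps_bounds:
  shows "\<forall>\<^sub>F n in sequentially. real n * ln (real n) + c * real n - 1 \<le> real (walk_steps c n)"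
    and "\<forall>\<^sub>F n in sequentially. real (walk_steps c n) \<le> real n * ln (real n) + c * real n"
    and "\<forall>\<^sub>F n in sequentially. 0 < walk_steps c n"
proof -
  have "\<forall>\<^sub>F x in at_top. x * ln x + c * x \<ge> (1::real)"
    by real_asymp
  then have ev: "\<forall>\<^sub>F n in sequentially. real n * ln (real n) + c * real n \<ge> 1"
    by (rule eventually_compose_filterlim[OF _ filterlim_real_sequentially])
  then show "\<forall>\<^sub>F n in sequentially. real n * ln (real n) + c * real n - 1 \<le> real (walk_steps c n)"
    by eventually_elim (unfold walk_steps_def, linarith)
  from ev show "\<forall>\<^sub>F n in sequentially. real (walk_steps c n) \<le> real n * ln (real n) + c * real n"
    by eventually_elim (unfold walk_steps_def, linarith)
  from ev show "\<forall>\<^sub>F n in sequentially. 0 < walk_steps c n"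
    by eventually_elim (unfold walk_steps_def, linarith)
qed

text \<open>The quantity is the expected number of leaves never chosen. Since
  \<open>0 < q < 1\<close> for \<open>n \<ge> 3\<close>, the power decreases in the exponent, so the
  upper bound on the number of steps gives the lower bound here and conversely.\<close>

lemma tendsto_untouched_leaves:
  "(\<lambda>n. (real n - 1) * (1 - 1 / (real n - 1)) ^ walk_steps c n) \<longlonglongrightarrow> exp (- c)"
proof (rule tendsto_sandwich)
  let ?f = "\<lambda>x::real. x * ln x + c * x"
  let ?q = "\<lambda>x::real. 1 - 1 / (x - 1)"
  have ev3: "\<forall>\<^sub>F n in sequentially. n \<ge> (3::nat)" by (rule eventually_ge_at_top)
  show "\<forall>\<^sub>F n in sequentially. (real n - 1) * ?q (real n) powr ?f (real n)
      \<le> (real n - 1) * ?q (real n) ^ walk_steps c n"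
    using walk_steps_bounds(2)[of c] ev3
    by eventually_elim (auto simp: powr_realpow[symmetric] intro!: mult_left_mono powr_mono')
  show "\<forall>\<^sub>F n in sequentially. (real n - 1) * ?q (real n) ^ walk_steps c n
      \<le> (real n - 1) * ?q (real n) powr (?f (real n) - 1)"
    using walk_steps_bounds(1)[of c] ev3
    by eventually_elim (auto simp: powr_realpow[symmetric] intro!: mult_left_mono powr_mono')
  have "((\<lambda>x. (x - 1) * ?q x powr ?f x) \<longlongrightarrow> exp (- c)) at_top"
    by real_asymp
  then show "(\<lambda>n. (real n - 1) * ?q (real n) powr ?f (real n)) \<longlonglongrightarrow> exp (- c)"
    by (rule filterlim_compose[OF _ filterlim_real_sequentially])
  have "((\<lambda>x. (x - 1) * ?q x powr (?f x - 1)) \<longlongrightarrow> exp (- c)) at_top"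
    by real_asymp
  then show "(\<lambda>n. (real n - 1) * ?q (real n) powr (?f (real n) - 1)) \<longlonglongrightarrow> exp (- c)"
    by (rule filterlim_compose[OF _ filterlim_real_sequentially])
qed

text \<open>The number of steps has order \<open>n * ln n\<close>. The denominator uses
  \<open>n - 2\<close> because \<open>q * N = n - 2\<close>.\<close>

lemma tendsto_walk_steps_over_square:
  "(\<lambda>n. real (walk_steps c n) / (real n - 2)\<^sup>2) \<longlonglongrightarrow> 0"
proof (rule tendsto_sandwich)
  show "\<forall>\<^sub>F n in sequentially. 0 \<le> real (walk_steps c n) / (real n - 2)\<^sup>2"
    by simp
  show "\<forall>\<^sub>F n in sequentially. real (walk_steps c n) / (real n - 2)\<^sup>2
      \<le> (real n * ln (real n) + c * real n) / (real n - 2)\<^sup>2"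
    using walk_steps_bounds(2)[of c] by eventually_elim (intro divide_right_mono, auto)
  have "((\<lambda>x. (x * ln x + c * x) / (x - 2)\<^sup>2) \<longlongrightarrow> 0) at_top"
    by real_asymp
  then show "(\<lambda>n. (real n * ln (real n) + c * real n) / (real n - 2)\<^sup>2) \<longlonglongrightarrow> 0"
    by (rule filterlim_compose[OF _ filterlim_real_sequentially])
qed auto

section \<open>Limits of the generating functions\<close>

lemma tendsto_expectation_leaf_power:
  fixes w :: complex
  assumes "norm (1 + w) \<le> 1"
  shows "(\<lambda>n. measure_pmf.expectation (star_walk n (walk_steps c n)) (\<lambda>g. (1 + w) ^ leaf_fixed_points n g))
    \<longlonglongrightarrow> exp (of_real (1 + exp (- c)) * w)"
proof -
  let ?k = "walk_steps c" and ?N = "\<lambda>n. real n - 1"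
  let ?q = "\<lambda>n. (1 - 1 / ?N n) ^ ?k n"
  let ?E = "\<lambda>n. measure_pmf.expectation (star_walk n (?k n)) (\<lambda>g. (1 + w) ^ leaf_fixed_points n g)"
  note u = tendsto_untouched_leaves[of c] and k = tendsto_walk_steps_over_square[of c]
  have inv0: "(\<lambda>n. 1 / ?N n) \<longlonglongrightarrow> 0" by real_asymp
  have ev3: "\<forall>\<^sub>F n in sequentially. n \<ge> (3::nat)" by (rule eventually_ge_at_top)
  have q0: "?q \<longlonglongrightarrow> 0"
  proof (rule Lim_transform_eventually)
    show "(\<lambda>n. (?N n * ?q n) * (1 / ?N n)) \<longlonglongrightarrow> 0"
      using tendsto_mult[OF u inv0] by simp
    show "\<forall>\<^sub>F n in sequentially. (?N n * ?q n) * (1 / ?N n) = ?q n"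
      using ev3 by eventually_elim auto
  qed
  have L: "(\<lambda>n. mean_bound n (?k n)) \<longlonglongrightarrow> 1 + exp (- c)"
    unfolding mean_bound_def by (intro tendsto_intros u)
  have lim: "(\<lambda>n. exp (of_real (1 - ?q n + ?N n * ?q n) * w)) \<longlonglongrightarrow> exp (of_real (1 - 0 + exp (- c)) * w)"
    by (intro tendsto_intros u q0)
  \<comment> \<open>The error bound regrouped into factors with known limits:
    \<open>N * q ^ k\<close> and \<open>mean_bound\<close> converge, while \<open>q ^ k\<close>,
    \<open>1 / N\<close> and \<open>k / (n - 2)\<^sup>2\<close> vanish.\<close>
  define B where "B n = exp 2 * norm w ^ 2 * ((?N n * ?q n) * ?q n)
      + 3 * exp 2 * norm w ^ 2 * ((real (?k n) / (real n - 2)\<^sup>2) * (mean_bound n (?k n))\<^sup>2)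
      + norm w * (1 / ?N n + real (?k n) / (real n - 2)\<^sup>2)" for n
  have B: "B \<longlonglongrightarrow> exp 2 * norm w ^ 2 * (exp (- c) * 0)
      + 3 * exp 2 * norm w ^ 2 * (0 * (1 + exp (- c))\<^sup>2) + norm w * (0 + 0)"
    unfolding B_def by (intro tendsto_intros u q0 k L inv0)
  have "(\<lambda>n. ?E n - exp (of_real (1 - ?q n + ?N n * ?q n) * w)) \<longlonglongrightarrow> 0"
  proof (rule Lim_null_comparison)
    show "B \<longlonglongrightarrow> 0" using B by simp
    show "\<forall>\<^sub>F n in sequentially. norm (?E n - exp (of_real (1 - ?q n + ?N n * ?q n) * w)) \<le> B n"
      using ev3
    proof eventually_elim
      case (elim n)
      let ?P = "\<Sum>s<?k n. measure_pmf.expectation (star_walk n s) (\<lambda>g. of_bool (g 1 = 1)) :: real"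
      have qN: "(1 - 1 / ?N n) * ?N n = real n - 2"
        using elim by (simp add: field_simps)
      have "norm w / ?N n * ?P \<le> norm w / ?N n * (1 + real (?k n) / ?N n)"
        using elim by (intro mult_left_mono sum_prob_star_walk_fixes_centre_le) auto
      also have "\<dots> = norm w * (1 / ?N n + real (?k n) / (?N n)\<^sup>2)"
        by (simp add: algebra_simps power2_eq_square)
      also have "\<dots> \<le> norm w * (1 / ?N n + real (?k n) / (real n - 2)\<^sup>2)"
        using elim by (intro mult_left_mono add_mono divide_left_mono power_mono) auto
      finally have P: "norm w / ?N n * ?P \<le> norm w * (1 / ?N n + real (?k n) / (real n - 2)\<^sup>2)" .
      have "norm (?E n - exp (of_real (1 - ?q n + ?N n * ?q n) * w))
        \<le> exp 2 * ?N n * (norm w * ?q n)\<^sup>2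
          + 3 * exp 2 * real (?k n) * (norm w * mean_bound n (?k n) / (real n - 2))\<^sup>2 + norm w / ?N n * ?P"
        using norm_expectation_leaf_power_minus_exp_le[OF elim assms, of "?k n"] unfolding qN .
      also have "exp 2 * ?N n * (norm w * ?q n)\<^sup>2 = exp 2 * norm w ^ 2 * ((?N n * ?q n) * ?q n)"
        by (simp add: power2_eq_square mult_ac)
      also have "3 * exp 2 * real (?k n) * (norm w * mean_bound n (?k n) / (real n - 2))\<^sup>2
        = 3 * exp 2 * norm w ^ 2 * ((real (?k n) / (real n - 2)\<^sup>2) * (mean_bound n (?k n))\<^sup>2)"
        by (simp add: power_mult_distrib power_divide)
      finally show ?case using P by (simp add: B_def)
    qed
  qed
  from tendsto_add[OF this lim] show ?thesis by simp
qed

text \<open>Restoring the centre changes the exponent only if \<open>g 1 = 1\<close>, an event of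
  probability at most \<open>1 / N\<close>, and then the power moves by at most
  \<open>2\<close>.\<close>

lemma tendsto_expectation_fixed_points_power:
  fixes z :: complex
  assumes "norm z \<le> 1"
  shows "(\<lambda>n. measure_pmf.expectation (star_walk n (walk_steps c n)) (\<lambda>g. z ^ num_fixed_points n g))
    \<longlonglongrightarrow> exp (of_real (1 + exp (- c)) * (z - 1))"
proof -
  let ?k = "walk_steps c"
  let ?E = "\<lambda>n f. measure_pmf.expectation (star_walk n (?k n)) f :: complex"
  have "(\<lambda>n. ?E n (\<lambda>g. z ^ num_fixed_points n g) - ?E n (\<lambda>g. z ^ leaf_fixed_points n g)) \<longlonglongrightarrow> 0"
  proof (rule Lim_null_comparison)
    show "(\<lambda>n. 2 * (1 / (real n - 1))) \<longlonglongrightarrow> 0" by real_asymp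
    show "\<forall>\<^sub>F n in sequentially. norm (?E n (\<lambda>g. z ^ num_fixed_points n g)
        - ?E n (\<lambda>g. z ^ leaf_fixed_points n g)) \<le> 2 * (1 / (real n - 1))"
      using eventually_ge_at_top[of "2::nat"] walk_steps_bounds(3)[of c]
    proof eventually_elim
      case (elim n)
      then obtain t where t: "?k n = Suc t" by (cases "?k n") auto
      have "norm (z ^ num_fixed_points n g - z ^ leaf_fixed_points n g) \<le> 2 * of_bool (g 1 = 1)" for g
      proof -
        have "norm (z ^ Suc a - z ^ a) \<le> 2" for a
          using norm_triangle_ineq4[of "z ^ Suc a" "z ^ a"] assms
            power_le_one[of "norm z" "Suc a"] power_le_one[of "norm z" a]
          by (simp add: norm_power[symmetric] del: power_Suc)
        then show ?thesis using elim by (simp add: num_fixed_points_eq_leaf_fixed_points)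
      qed
      then have "norm (?E n (\<lambda>g. z ^ num_fixed_points n g - z ^ leaf_fixed_points n g))
          \<le> measure_pmf.expectation (star_walk n (?k n)) (\<lambda>g. 2 * of_bool (g 1 = 1))"
        using elim by (intro order.trans[OF integral_norm_bound] integral_mono) auto
      also have "\<dots> \<le> 2 * (1 / (real n - 1))"
        unfolding t using prob_star_walk_fixes_centre_Suc_le[of n t] elim by simp
      finally show ?case using elim by simp
    qed
  qed
  from tendsto_add[OF this tendsto_expectation_leaf_power[of "z - 1" c]] show ?thesis
    using assms by simp
qed

section \<open>Characteristic functions and the Poisson limit\<close>

text \<open>Links both sides to generating functions, evaluated at \<open>iexp \<theta>\<close>, a
  point of modulus one and hence inside the closed unit disc treated above.\<close>

lemma char_distr_pmf_nat:
  fixes f :: "'a \<Rightarrow> nat"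
  shows "char (distr (measure_pmf p) borel (\<lambda>x. real (f x))) \<theta>
    = measure_pmf.expectation p (\<lambda>x. iexp \<theta> ^ f x)"
  unfolding char_def
  by (subst integral_distr) (auto simp: exp_of_nat_mult[symmetric] algebra_simps)

text \<open>The weighted powers form an exponential series. Boundedness on the unit disc gives the
  integrability that turns the expectation into this series.\<close>

lemma expectation_poisson_power:
  fixes z :: complex
  assumes "norm z \<le> 1" "r > 0"
  shows "measure_pmf.expectation (poisson_pmf r) (\<lambda>k. z ^ k) = exp (of_real r * (z - 1))"
proof -
  have "(\<lambda>k. pmf (poisson_pmf r) k *\<^sub>R z ^ k) = (\<lambda>k. ((of_real r * z) ^ k /\<^sub>R fact k) * of_real (exp (- r)))"
    using assms by (simp add: scaleR_conv_of_real power_mult_distrib field_simps)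
  also have "\<dots> sums (exp (of_real r * z) * of_real (exp (- r)))"
    by (intro sums_mult2 exp_converges)
  finally have sums: "(\<lambda>k. pmf (poisson_pmf r) k *\<^sub>R z ^ k) sums exp (of_real r * (z - 1))"
    by (simp add: exp_of_real[symmetric] exp_add[symmetric] algebra_simps)
  have int: "integrable (poisson_pmf r) (\<lambda>k. z ^ k)"
    using assms by (intro measure_pmf.integrable_const_bound[where B = 1]) (auto simp: norm_power power_le_one)
  then have int': "integrable (count_space UNIV) (\<lambda>k. pmf (poisson_pmf r) k *\<^sub>R z ^ k)"
    unfolding measure_pmf_eq_density by (subst (asm) integrable_density) auto
  have "measure_pmf.expectation (poisson_pmf r) (\<lambda>k. z ^ k)
      = (\<integral>k. pmf (poisson_pmf r) k *\<^sub>R z ^ k \<partial>count_space UNIV)"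
    unfolding measure_pmf_eq_density by (subst integral_density) auto
  also have "\<dots> = (\<Sum>k. pmf (poisson_pmf r) k *\<^sub>R z ^ k)"
    by (rule integral_count_space_nat[OF int'])
  also have "\<dots> = exp (of_real r * (z - 1))"
    using sums by (rule sums_unique[symmetric])
  finally show ?thesis .
qed

theorem theorem1p2:
  fixes c :: real
  shows "weak_conv_m
    (\<lambda>n. distr (measure_pmf (conv_power (star_transposition_pmf n) (walk_steps c n)))
           borel (\<lambda>\<pi>. real (num_fixed_points n \<pi>)))
    (distr (measure_pmf (poisson_pmf (1 + exp (- c)))) borel real)"
proof (rule levy_continuity)
  fix \<theta> :: real
  let ?r = "1 + exp (- c)"
  have "?r > 0" by (simp add: add_pos_pos)
  then have "char (distr (measure_pmf (poisson_pmf ?r)) borel real) \<theta> = exp (of_real ?r * (iexp \<theta> - 1))"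
    using char_distr_pmf_nat[of "poisson_pmf ?r" "\<lambda>k. k" \<theta>]
      expectation_poisson_power[of "iexp \<theta>" ?r] by simp
  then show "(\<lambda>n. char (distr (measure_pmf (star_walk n (walk_steps c n))) borel
        (\<lambda>\<pi>. real (num_fixed_points n \<pi>))) \<theta>)
      \<longlonglongrightarrow> char (distr (measure_pmf (poisson_pmf ?r)) borel real) \<theta>"
    unfolding char_distr_pmf_nat
    using tendsto_expectation_fixed_points_power[of "iexp \<theta>" c] by simp
qed (auto intro!: prob_space.real_distribution_distr prob_space_measure_pmf)

end
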